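(* There is a large enough constant $C>0$ such that the following holds. Fix $\varepsilon\in(0,1)$, $0<t<1$, and a local property $\mathcal{P}$ of sequences $f:[n]\to\mathbb{R}$, where $n\ge\frac{C\left(\log\frac1\varepsilon+\log\frac1{1-t}\right)^2}{\varepsilon^2(1-t)}$. There exists a one-sided error $\varepsilon$-tester for $\mathcal{P}$ that works in the presence of a $t$-online erasure fixed-rate adversary and has query complexity $O\left(\frac{\log(\varepsilon n)}{\varepsilon(1-t)}\right)$. For a corruption adversary, the same is true without the one-sided error guarantee.
   Context: $\log$ is base 2; $[n]=\{1,\dots,n\}$. A property $\mathcal{P}$ of sequences $f:[n]\to\mathbb{R}$ is local if there is a family $\mathcal{F}\subseteq\mathbb{R}^2$ of forbidden pairs such that $f\in\mathcal{P}$ iff $(f(i),f(i+1))\notin\mathcal{F}$ for all $i\in[n-1]$. Online model. Access to the input $f$ is via a sequence of oracles $\mathcal{O}_1,\mathcal{O}_2,\dots$, where $\mathcal{O}_i$ answers the $i$-th query (batch size 1) and $\mathcal{O}_1=f$. After each query the adversary chooses the next oracle; its strategy may depend on the input, the tester's description, and all queries made so far, but not on the tester's future coin tosses. Let $\mathrm{Dist}$ denote Hamming distance (number of points with different answers). A $t$-online fixed-rate adversary must satisfy $\mathrm{Dist}(\mathcal{O}_i,\mathcal{O}_{i+1})\le\lfloor(i+1)t\rfloor-\lfloor it\rfloor$ for all $i\in\mathbb{N}$. An erasure adversary must satisfy $\mathcal{O}_{i+1}(x)\in\{\mathcal{O}_i(x),\perp\}$ for all $x$ ($\perp$ is the erasure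 symbol); a corruption adversary may change values arbitrarily within the range. $f$ is $\varepsilon$-far from $\mathcal{P}$ if at least an $\varepsilon$ fraction of the values of $f$ must be changed to obtain a sequence in $\mathcal{P}$. An (online) $\varepsilon$-tester for $\mathcal{P}$ working in the presence of a given type of adversary is a randomized algorithm that, for every adversarial strategy of that type, accepts with probability at least $2/3$ if $f\in\mathcal{P}$ and rejects with probability at least $2/3$ if $f$ is $\varepsilon$-far from $\mathcal{P}$. It has one-sided error if it always accepts every $f\in\mathcal{P}$. *)

theory Defs
  imports "HOL-Probability.Probability"
begin

definition sequences :: "nat \<Rightarrow> (nat \<Rightarrow> real) set" where
  "sequences n = {1..n} \<rightarrow>\<^sub>E UNIV"

definition local_property :: "nat \<Rightarrow> (nat \<Rightarrow> real) set \<Rightarrow> bool" where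
  "local_property n P \<longleftrightarrow> P \<subseteq> sequences n \<and>
     (\<exists>F :: (real \<times> real) set. \<forall>f\<in>sequences n.
        f \<in> P \<longleftrightarrow> (\<forall>i\<in>{1..<n}. (f i, f (i + 1)) \<notin> F))"

definition Dist :: "nat \<Rightarrow> (nat \<Rightarrow> 'a) \<Rightarrow> (nat \<Rightarrow> 'a) \<Rightarrow> nat" where
  "Dist n g h = card {x\<in>{1..n}. g x \<noteq> h x}"

text \<open>If \<open>P\<close> is empty then every sequence is far from it.\<close>

definition eps_far :: "nat \<Rightarrow> real \<Rightarrow> (nat \<Rightarrow> real) set \<Rightarrow> (nat \<Rightarrow> real) \<Rightarrow> bool" where
  "eps_far n \<epsilon> P f \<longleftrightarrow> (\<forall>g\<in>P. real (Dist n f g) \<ge> \<epsilon> * real n)"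

text \<open>\<open>None\<close> is the erasure symbol.\<close>

type_synonym query_oracle = "nat \<Rightarrow> real option"

text \<open>A strategy maps the list of the queries made so far, in chronological order, to the
  oracle that answers the next query: after the queries \<open>x\<^sub>1, \<dots>, x\<^sub>i\<close> the oracle
  with index \<open>i + 1\<close> is \<open>S [x\<^sub>1, \<dots>, x\<^sub>i]\<close>. The answers given so far are determined by the
  strategy and the queries.\<close>

type_synonym strategy = "nat list \<Rightarrow> query_oracle"

text \<open>The oracle \<open>S xs\<close> has index \<open>i = length xs + 1\<close>.\<close>

definition fixed_rate_strategy :: "nat \<Rightarrow> real \<Rightarrow> (nat \<Rightarrow> real) \<Rightarrow> strategy \<Rightarrow> bool" where
  "fixed_rate_strategy n t f S \<longleftrightarrow>
     (\<forall>y\<in>{1..n}. S [] y = Some (f y)) \<and>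
     (\<forall>xs\<in>lists {1..n}. \<forall>x\<in>{1..n}. let i = length xs + 1 in
        int (Dist n (S xs) (S (xs @ [x]))) \<le> \<lfloor>real (i + 1) * t\<rfloor> - \<lfloor>real i * t\<rfloor>)"

definition erasure_strategies :: "nat \<Rightarrow> real \<Rightarrow> (nat \<Rightarrow> real) \<Rightarrow> strategy set" where
  "erasure_strategies n t f = {S. fixed_rate_strategy n t f S \<and>
     (\<forall>xs\<in>lists {1..n}. \<forall>x\<in>{1..n}. \<forall>y\<in>{1..n}. S (xs @ [x]) y \<in> {S xs y, None})}"

definition corruption_strategies :: "nat \<Rightarrow> real \<Rightarrow> (nat \<Rightarrow> real) \<Rightarrow> strategy set" where
  "corruption_strategies n t f = {S. fixed_rate_strategy n t f S \<and>
     (\<forall>xs\<in>lists {1..n}. \<forall>y\<in>{1..n}. S xs y \<noteq> None)}"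

text \<open>A deterministic adaptive algorithm is a decision tree branching on the oracle's answers; a
  randomized algorithm is a probability distribution on such trees. A strategy never sees the
  tree that was drawn, only the queries already made.\<close>

datatype decision_tree =
  Accept | Reject | Query nat "real option \<Rightarrow> decision_tree"

type_synonym randomized_algorithm = "decision_tree pmf"

primrec queries_within :: "nat \<Rightarrow> decision_tree \<Rightarrow> bool" where
  "queries_within n Accept \<longleftrightarrow> True"
| "queries_within n Reject \<longleftrightarrow> True"
| "queries_within n (Query x k) \<longleftrightarrow> x \<in> {1..n} \<and> (\<forall>a. queries_within n (k a))"

primrec depth_at_most :: "decision_tree \<Rightarrow> nat \<Rightarrow> bool" where
  "depth_at_most Accept q \<longleftrightarrow> True"
| "depth_at_most Reject q \<longleftrightarrow> True"
| "depth_at_most (Query x k) q \<longleftrightarrow> q > 0 \<and> (\<forall>a. depth_at_most (k a) (q - 1))"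

text \<open>In \<open>accepts d S xs\<close>, the list \<open>xs\<close> holds the queries made before reaching \<open>d\<close>.\<close>

primrec accepts :: "decision_tree \<Rightarrow> strategy \<Rightarrow> nat list \<Rightarrow> bool" where
  "accepts Accept S xs \<longleftrightarrow> True"
| "accepts Reject S xs \<longleftrightarrow> False"
| "accepts (Query x k) S xs \<longleftrightarrow> accepts (k (S xs x)) S (xs @ [x])"

definition eps_tester ::
  "nat \<Rightarrow> real \<Rightarrow> (nat \<Rightarrow> real) set \<Rightarrow> ((nat \<Rightarrow> real) \<Rightarrow> strategy set) \<Rightarrow> randomized_algorithm \<Rightarrow> bool" where
  "eps_tester n \<epsilon> P Adv T \<longleftrightarrow>
     (\<forall>d\<in>set_pmf T. queries_within n d) \<and>
     (\<forall>f\<in>sequences n. \<forall>S\<in>Adv f.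
        (f \<in> P \<longrightarrow> measure_pmf.prob T {d. accepts d S []} \<ge> 2 / 3) \<and>
        (eps_far n \<epsilon> P f \<longrightarrow> measure_pmf.prob T {d. \<not> accepts d S []} \<ge> 2 / 3))"

definition one_sided_error ::
  "(nat \<Rightarrow> real) set \<Rightarrow> ((nat \<Rightarrow> real) \<Rightarrow> strategy set) \<Rightarrow> randomized_algorithm \<Rightarrow> bool" where
  "one_sided_error P Adv T \<longleftrightarrow> (\<forall>f\<in>P. \<forall>S\<in>Adv f. \<forall>d\<in>set_pmf T. accepts d S [])"

definition makes_at_most :: "nat \<Rightarrow> randomized_algorithm \<Rightarrow> bool" where
  "makes_at_most q T \<longleftrightarrow> (\<forall>d\<in>set_pmf T. depth_at_most d q)"

end

theory Submission
  imports Defs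
begin

text \<open>Call a pair of positions consistent with \<open>f\<close> if some member of \<open>P\<close> agrees with \<open>f\<close> at both.
  Locality allows members of \<open>P\<close> to be glued at a common value, so consistency is transitive along
  the line, and \<open>f\<close> agrees with a member of \<open>P\<close> on every set of pairwise consistent positions.
  Hence, as in monotonicity testing, if \<open>f\<close> is \<open>\<epsilon>\<close>-far then a pair at distance \<open>d\<close>, drawn with
  probability proportional to \<open>1 / d\<close>, is inconsistent with probability of order \<open>\<epsilon> / log n\<close>;
  for large \<open>n\<close> the hypothesis gives \<open>\<epsilon>\<^sup>2 * n \<ge> 1\<close>, hence \<open>log n \<le> 2 * log (\<epsilon> * n)\<close>.

  Any \<open>\<lceil>1 / (1 - t)\<rceil> + 1\<close> consecutive queries contain two adjacent ones between which a
  fixed-rate adversary cannot change anything. The tester queries a random pair there and spends the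
  other queries on dummies. Both ends of the pair are uniform and independent of the past, so the
  adversary rarely hits them: the number of its changes times the number of pairs is small against
  \<open>n\<close>. For bounded \<open>n\<close> the hypothesis forces \<open>n * t < 1\<close>; then the adversary is powerless during
  the first \<open>n\<close> queries, and the tester reads the whole input.\<close>

subsection \<open>Inconsistent pairs\<close>

text \<open>Every adjacent pair of the splice is one of \<open>g\<close> or of \<open>h\<close>. At
  the seam \<open>(a, a + 1)\<close> it is one of \<open>h\<close>, because
  \<open>g a = h a\<close>.\<close>

lemma local_property_splice:
  assumes loc: "local_property n P" and g: "g \<in> P" and h: "h \<in> P" and eq: "g a = h a"
  shows "(\<lambda>i. if i \<le> a then g i else h i) \<in> P" (is "?s \<in> P")
proof -
  obtain F where sub: "P \<subseteq> sequences n"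
    and F: "\<And>f. f \<in> sequences n \<Longrightarrow> f \<in> P \<longleftrightarrow> (\<forall>i\<in>{1..<n}. (f i, f (i + 1)) \<notin> F)"
    using loc unfolding local_property_def by blast
  have "?s \<in> sequences n"
    using sub g h by (auto simp: sequences_def PiE_def extensional_def)
  moreover have "(?s i, ?s (i + 1)) \<notin> F" if i: "i \<in> {1..<n}" for i
  proof -
    have "(g i, g (i + 1)) \<notin> F" "(h i, h (i + 1)) \<notin> F"
      using F[of g] F[of h] g h sub i by blast+
    moreover have "i = a" if "i \<le> a" "\<not> i + 1 \<le> a"
      using that by simp
    ultimately show ?thesis
      using eq by (cases "i = a") auto
  qed
  ultimately show ?thesis
    using F[of ?s] by blast
qed

definition consistent_at :: "(nat \<Rightarrow> real) set \<Rightarrow> (nat \<Rightarrow> real) \<Rightarrow> nat \<Rightarrow> nat \<Rightarrow> bool" where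
  "consistent_at P f x y \<longleftrightarrow> (\<exists>g\<in>P. g x = f x \<and> g y = f y)"

lemma consistent_at_sym: "consistent_at P f x y \<Longrightarrow> consistent_at P f y x"
  by (auto simp: consistent_at_def)

lemma consistent_at_refl: "consistent_at P f x y \<Longrightarrow> consistent_at P f x x"
  by (auto simp: consistent_at_def)

lemma consistent_at_trans:
  assumes loc: "local_property n P" and "x < y" "y < z"
    and xy: "consistent_at P f x y" and yz: "consistent_at P f y z"
  shows "consistent_at P f x z"
proof -
  obtain g h where gh: "g \<in> P" "g x = f x" "g y = f y" "h \<in> P" "h y = f y" "h z = f z"
    using xy yz by (auto simp: consistent_at_def)
  then have "(\<lambda>i. if i \<le> y then g i else h i) \<in> P"
    by (intro local_property_splice[OF loc]) auto
  then show ?thesis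
    unfolding consistent_at_def using gh assms(2,3)
    by (intro bexI[of _ "\<lambda>i. if i \<le> y then g i else h i"]) auto
qed

text \<open>Points are added from left to right. A witness for \<open>A\<close> is spliced at
  \<open>Max A\<close> with a witness for the pair formed by \<open>Max A\<close> and the new
  point.\<close>

lemma pairwise_consistent_extension:
  assumes loc: "local_property n P" and "finite A" "P \<noteq> {}"
    and "\<And>x y. x \<in> A \<Longrightarrow> y \<in> A \<Longrightarrow> consistent_at P f x y"
  shows "\<exists>g\<in>P. \<forall>x\<in>A. g x = f x"
  using assms(2,4)
proof (induction A rule: finite_linorder_max_induct)
  case empty
  then show ?case using \<open>P \<noteq> {}\<close> by auto
next
  case (insert b A)
  obtain g where g: "g \<in> P" "\<forall>x\<in>A. g x = f x"
    using insert.IH insert.prems by blast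
  show ?case
  proof (cases "A = {}")
    case True
    then show ?thesis using insert.prems[of b b] by (auto simp: consistent_at_def)
  next
    case False
    define a where "a = Max A"
    have a: "a \<in> A" "\<And>x. x \<in> A \<Longrightarrow> x \<le> a"
      using False insert.hyps(1) by (auto simp: a_def)
    obtain h where h: "h \<in> P" "h a = f a" "h b = f b"
      using insert.prems[of a b] a by (auto simp: consistent_at_def)
    have "(\<lambda>i. if i \<le> a then g i else h i) \<in> P"
      using g h a by (intro local_property_splice[OF loc]) auto
    moreover have "\<forall>x\<in>insert b A. (if x \<le> a then g x else h x) = f x"
      using g h a insert.hyps(2) by (auto simp: not_le[symmetric])
    ultimately show ?thesis by (intro bexI[of _ "\<lambda>i. if i \<le> a then g i else h i"])
  qed
qed

section \<open>Harmonic weights of inconsistent pairs\<close>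

definition violations :: "nat \<Rightarrow> (nat \<Rightarrow> real) set \<Rightarrow> (nat \<Rightarrow> real) \<Rightarrow> (nat \<times> nat) set" where
  "violations n P f = {(x, y). x \<in> {1..n} \<and> y \<in> {1..n} \<and> x < y \<and> \<not> consistent_at P f x y}"

text \<open>The weighted degree of \<open>x\<close> in the graph of inconsistent pairs, an edge
  weighing the inverse of its length, just as in the distribution of the tested pairs.\<close>

definition violation_weight :: "nat \<Rightarrow> (nat \<Rightarrow> real) set \<Rightarrow> (nat \<Rightarrow> real) \<Rightarrow> nat \<Rightarrow> real" where
  "violation_weight n P f x =
     (\<Sum>y\<in>{y\<in>{1..n}. y \<noteq> x \<and> \<not> consistent_at P f x y}. 1 / \<bar>real x - real y\<bar>)"

text \<open>By transitivity every point strictly between the two ends of a violation violates with one of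
  them, with weight at least the inverse of the length of the interval.\<close>

lemma violation_weight_ends:
  assumes loc: "local_property n P" and xz: "(x, z) \<in> violations n P f"
  shows "violation_weight n P f x + violation_weight n P f z \<ge> 1"
proof -
  define c where "c = 1 / (real z - real x)"
  have x: "x \<in> {1..n}" "z \<in> {1..n}" "x < z" and viol: "\<not> consistent_at P f x z"
    using xz by (auto simp: violations_def)
  define A where "A = {y\<in>{x<..z}. \<not> consistent_at P f x y}"
  define B where "B = {y\<in>{x..<z}. \<not> consistent_at P f z y}"
  have c0: "c > 0" using x by (simp add: c_def)
  have WA: "real (card A) * c \<le> violation_weight n P f x"
  proof -
    have "real (card A) * c = (\<Sum>y\<in>A. c)" by simp
    also have "\<dots> \<le> (\<Sum>y\<in>A. 1 / \<bar>real x - real y\<bar>)"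
      unfolding c_def using x by (intro sum_mono divide_left_mono) (auto simp: A_def)
    also have "\<dots> \<le> violation_weight n P f x"
      unfolding violation_weight_def using x by (intro sum_mono2) (auto simp: A_def)
    finally show ?thesis .
  qed
  have WB: "real (card B) * c \<le> violation_weight n P f z"
  proof -
    have "real (card B) * c = (\<Sum>y\<in>B. c)" by simp
    also have "\<dots> \<le> (\<Sum>y\<in>B. 1 / \<bar>real z - real y\<bar>)"
      unfolding c_def using x by (intro sum_mono divide_left_mono) (auto simp: B_def)
    also have "\<dots> \<le> violation_weight n P f z"
      unfolding violation_weight_def using x by (intro sum_mono2) (auto simp: B_def)
    finally show ?thesis .
  qed
  \<comment> \<open>The ends are covered as well: \<open>z\<close> lies in \<open>A\<close> and
    \<open>x\<close> in \<open>B\<close>. So the two sets have at least \<open>z - x\<close>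
    elements in total, each of weight at least \<open>c\<close>.\<close>
  have "{x..z} \<subseteq> A \<union> B"
  proof (rule subsetI)
    fix y assume y: "y \<in> {x..z}"
    have "\<not> consistent_at P f x y \<or> \<not> consistent_at P f y z" if "x < y" "y < z"
      using consistent_at_trans[OF loc that] viol by blast
    then show "y \<in> A \<union> B"
      using y viol x by (auto simp: A_def B_def dest: consistent_at_sym) (metis consistent_at_sym le_neq_implies_less)+
  qed
  then have "card {x..z} \<le> card A + card B"
    by (intro order_trans[OF card_mono card_Un_le]) (auto simp: A_def B_def)
  then have "real z - real x \<le> real (card A) + real (card B)"
    using x by (simp add: of_nat_diff)
  then have "1 \<le> (real (card A) + real (card B)) * c"
    using x by (simp add: c_def field_simps)
  then show ?thesis using WA WB by (simp add: algebra_simps)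
qed

text \<open>Handshake count: each violation is seen from both of its ends, so the index set is
  \<open>V\<close> together with its mirror image.\<close>

lemma sum_violation_weight:
  "(\<Sum>x=1..n. violation_weight n P f x) =
     2 * (\<Sum>(x, y)\<in>violations n P f. 1 / (real y - real x))"
proof -
  define V where "V = violations n P f"
  define A where "A = Sigma {1..n} (\<lambda>x. {y\<in>{1..n}. y \<noteq> x \<and> \<not> consistent_at P f x y})"
  have fin: "finite V"
    by (rule finite_subset[of _ "{1..n} \<times> {1..n}"]) (auto simp: V_def violations_def)
  have "(\<Sum>x=1..n. violation_weight n P f x) = (\<Sum>(x, y)\<in>A. 1 / \<bar>real x - real y\<bar>)"
    unfolding violation_weight_def A_def by (subst sum.Sigma) auto
  also have "A = V \<union> prod.swap ` V"
    by (auto simp: A_def V_def violations_def image_iff dest: consistent_at_sym)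
  also have "(\<Sum>(x, y)\<in>\<dots>. 1 / \<bar>real x - real y\<bar>) =
      (\<Sum>(x, y)\<in>V. 1 / \<bar>real x - real y\<bar>) + (\<Sum>(x, y)\<in>prod.swap ` V. 1 / \<bar>real x - real y\<bar>)"
    using fin by (intro sum.union_disjoint) (auto simp: V_def violations_def)
  also have "(\<Sum>(x, y)\<in>prod.swap ` V. 1 / \<bar>real x - real y\<bar>) =
      (\<Sum>(x, y)\<in>V. 1 / \<bar>real x - real y\<bar>)"
    by (subst sum.reindex) (auto intro!: sum.cong simp: abs_minus_commute)
  also have "(\<Sum>(x, y)\<in>V. 1 / \<bar>real x - real y\<bar>) = (\<Sum>(x, y)\<in>V. 1 / (real y - real x))"
    by (intro sum.cong) (auto simp: V_def violations_def)
  finally show ?thesis by (simp add: V_def)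
qed

text \<open>The set \<open>H\<close> of points of weight at least 1/2 meets every violation, as the
  two ends weigh at least 1 together. Off \<open>H\<close> the input therefore agrees with a member
  of \<open>P\<close>, and farness makes \<open>H\<close> large. One factor 1/2 is the weight
  threshold, the other the double count of violations.\<close>

lemma eps_far_violation_sum:
  assumes loc: "local_property n P" and n: "n \<ge> 2" and f: "f \<in> sequences n"
    and \<epsilon>: "\<epsilon> \<le> 1" and far: "eps_far n \<epsilon> P f"
  shows "(\<Sum>(x, y)\<in>violations n P f. 1 / (real y - real x)) \<ge> \<epsilon> * real n / 4"
proof -
  define W where "W = violation_weight n P f"
  define H where "H = {x\<in>{1..n}. W x \<ge> 1 / 2}"
  have W0: "W x \<ge> 0" for x
    unfolding W_def violation_weight_def by (intro sum_nonneg) auto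
  have cons: "consistent_at P f x y" if xy: "x \<in> {1..n} - H" "y \<in> {1..n} - H" "x < y" for x y
  proof (rule ccontr)
    assume "\<not> ?thesis"
    then have "W x + W y \<ge> 1"
      unfolding W_def using xy by (intro violation_weight_ends[OF loc]) (auto simp: violations_def)
    then show False using xy by (auto simp: H_def)
  qed
  \<comment> \<open>A position inconsistent with itself is inconsistent with all others. A
    neighbour, which exists as \<open>n \<ge> 2\<close>, alone contributes weight 1.\<close>
  have refl: "consistent_at P f x x" if x: "x \<in> {1..n} - H" for x
  proof (rule ccontr)
    assume no: "\<not> ?thesis"
    define y where "y = (if x < n then x + 1 else x - 1)"
    have y: "y \<in> {1..n}" "y \<noteq> x" "\<bar>real x - real y\<bar> = 1"
      using x n by (auto simp: y_def of_nat_diff)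
    have "1 / \<bar>real x - real y\<bar> \<le> W x"
      unfolding W_def violation_weight_def
      using y no consistent_at_refl by (intro member_le_sum) auto
    then show False using y x by (auto simp: H_def)
  qed
  have card_H: "real (card H) \<ge> \<epsilon> * real n"
  proof (cases "P = {}")
    case True
    then have "{1..n} \<subseteq> H"
      using refl unfolding consistent_at_def by blast
    then have "H = {1..n}"
      by (auto simp: H_def)
    then show ?thesis using mult_right_mono[OF \<epsilon>, of "real n"] by simp
  next
    case False
    have "consistent_at P f x y" if "x \<in> {1..n} - H" "y \<in> {1..n} - H" for x y
    proof (cases x y rule: linorder_cases)
      case less
      then show ?thesis using cons that by blast
    next
      case equal
      then show ?thesis using refl that by blast
    next
      case greater
      then show ?thesis using cons that consistent_at_sym by blast
    qed
    then obtain g where g: "g \<in> P" "\<forall>x\<in>{1..n} - H. g x = f x"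
      using pairwise_consistent_extension[OF loc, of "{1..n} - H" f] False by auto
    have "\<epsilon> * real n \<le> real (Dist n f g)"
      using far g unfolding eps_far_def by auto
    also have "Dist n f g \<le> card H"
      unfolding Dist_def
    proof (rule card_mono)
      show "finite H" by (simp add: H_def)
      show "{x\<in>{1..n}. f x \<noteq> g x} \<subseteq> H"
      proof (rule subsetI)
        fix x assume "x \<in> {x\<in>{1..n}. f x \<noteq> g x}"
        then show "x \<in> H" using g(2)[rule_format, of x] by (cases "x \<in> H") auto
      qed
    qed
    finally show ?thesis by simp
  qed
  have "real (card H) / 2 = (\<Sum>x\<in>H. 1 / 2)" by simp
  also have "\<dots> \<le> (\<Sum>x\<in>H. W x)"
    by (intro sum_mono) (simp add: H_def)
  also have "\<dots> \<le> (\<Sum>x=1..n. W x)"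
    using W0 by (intro sum_mono2) (auto simp: H_def)
  finally show ?thesis
    using card_H sum_violation_weight[of n P f] by (simp add: W_def)
qed

section \<open>The distribution of the tested pairs\<close>

lemma harm_le_ln: "n > 0 \<Longrightarrow> harm n \<le> ln (real n) + 1"
  using decseqD[OF decseq_harm_diff_ln, of 0 "n - 1"] by (simp add: harm_expand)

text \<open>The pair \<open>(x, y)\<close> has \<open>x\<close> uniform and \<open>y = x + d\<close> modulo \<open>n\<close>, where \<open>d\<close> is independent of
  \<open>x\<close> and has probability proportional to \<open>1 / d\<close>. The wrap-around makes both marginals uniform.\<close>

lemma violating_pair_distribution:
  assumes n: "n \<ge> 2"
  obtains D :: "(nat \<times> nat) pmf" where
    "set_pmf D \<subseteq> {1..n} \<times> {1..n}"
    "\<And>A. A \<subseteq> {1..n} \<Longrightarrow> measure_pmf.prob D {(x, y). x \<in> A \<or> y \<in> A} \<le> 2 * real (card A) / real n"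
    "\<And>\<epsilon> P f. local_property n P \<Longrightarrow> f \<in> sequences n \<Longrightarrow> \<epsilon> \<le> 1 \<Longrightarrow> eps_far n \<epsilon> P f \<Longrightarrow>
       measure_pmf.prob D {(x, y). \<not> consistent_at P f x y} \<ge> \<epsilon> / (4 * harm (n - 1))"
proof -
  define H :: real where "H = harm (n - 1)"
  \<comment> \<open>The divisor \<open>real n * H\<close> normalizes: there are \<open>n\<close>
    choices of \<open>x\<close>, and the inverses of the distances \<open>d\<close> sum to
    \<open>H\<close>.\<close>
  define w where "w = (\<lambda>d::nat. 1 / (real n * H * real d))"
  define I where "I = {1..n} \<times> {1..<n}"
  define \<phi> where "\<phi> = (\<lambda>p. if p \<in> I then w (snd p) else 0)"
  define E where "E = embed_pmf \<phi>"
  \<comment> \<open>Addition modulo \<open>n\<close> with representatives 1 to \<open>n\<close>; one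
    subtraction is enough because \<open>d < n\<close>.\<close>
  define y where "y = (\<lambda>(x, d). if x + d \<le> n then x + d else x + d - n)"
  define D where "D = map_pmf (\<lambda>p. (fst p, y p)) E"
  have H: "H > 0" unfolding H_def using n by (intro harm_pos) simp
  have fin: "finite I" by (simp add: I_def)
  have w_nonneg: "w d \<ge> 0" for d using H by (simp add: w_def)
  have sum_w: "real n * (\<Sum>d=1..<n. w d) = 1"
  proof -
    have "(\<Sum>d=1..<n. w d) = (\<Sum>d=1..n - 1. inverse (real d)) / (real n * H)"
      unfolding w_def sum_divide_distrib using n by (intro sum.cong) (auto simp: field_simps)
    also have "\<dots> = 1 / real n" using H by (simp add: H_def[unfolded harm_def])
    finally show ?thesis using n by simp
  qed
  have "(\<integral>\<^sup>+p. ennreal (\<phi> p) \<partial>count_space UNIV) = (\<integral>\<^sup>+p. ennreal (\<phi> p) \<partial>count_space I)"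
    by (subst nn_integral_count_space_indicator) (auto intro!: nn_integral_cong simp: \<phi>_def split: split_indicator)
  also have "\<dots> = ennreal (\<Sum>p\<in>I. \<phi> p)"
    using fin by (subst nn_integral_count_space_finite) (auto simp: \<phi>_def w_nonneg intro!: sum_ennreal)
  also have "(\<Sum>p\<in>I. \<phi> p) = (\<Sum>(x, d)\<in>I. w d)"
    by (intro sum.cong) (auto simp: \<phi>_def)
  also have "\<dots> = 1"
    unfolding I_def using sum_w by (simp add: sum.cartesian_product[symmetric])
  finally have "(\<integral>\<^sup>+p. ennreal (\<phi> p) \<partial>count_space UNIV) = 1" by simp
  then have pmf_E: "pmf E p = \<phi> p" for p
    unfolding E_def by (intro pmf_embed_pmf) (auto simp: \<phi>_def w_nonneg)
  have set_E: "set_pmf E \<subseteq> I"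
    by (auto simp: set_pmf_eq pmf_E \<phi>_def)
  have y_in: "y p \<in> {1..n}" if "p \<in> I" for p
    using that by (auto simp: I_def y_def)
  have prob_E: "measure_pmf.prob E X = (\<Sum>(x, d)\<in>X \<inter> I. w d)" for X
  proof -
    have "measure_pmf.prob E X = measure_pmf.prob E (X \<inter> I)"
      using set_E by (intro measure_prob_cong_0) (auto simp: set_pmf_eq)
    also have "\<dots> = (\<Sum>p\<in>X \<inter> I. \<phi> p)"
      using fin by (subst measure_measure_pmf_finite) (auto simp: pmf_E)
    also have "\<dots> = (\<Sum>(x, d)\<in>X \<inter> I. w d)"
      by (intro sum.cong) (auto simp: \<phi>_def)
    finally show ?thesis .
  qed
  \<comment> \<open>For fixed \<open>d\<close> an injective \<open>u\<close> sends at most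
    \<open>card A\<close> of the \<open>n\<close> values of \<open>x\<close> into \<open>A\<close>.
    This serves both ends of the pair: the first projection and the cyclic shift \<open>y\<close>
    are both injective in \<open>x\<close>.\<close>
  have uniform: "(\<Sum>(x, d)\<in>{p. u p \<in> A} \<inter> I. w d) \<le> real (card A) / real n"
    if A: "A \<subseteq> {1..n}" and inj: "\<And>d. d \<in> {1..<n} \<Longrightarrow> inj_on (\<lambda>x. u (x, d)) {1..n}" for A and u :: "nat \<times> nat \<Rightarrow> nat"
  proof -
    have "{p. u p \<in> A} \<inter> I = prod.swap ` Sigma {1..<n} (\<lambda>d. {x\<in>{1..n}. u (x, d) \<in> A})"
      by (force simp: I_def)
    then have "(\<Sum>(x, d)\<in>{p. u p \<in> A} \<inter> I. w d) =
        (\<Sum>(d, x)\<in>Sigma {1..<n} (\<lambda>d. {x\<in>{1..n}. u (x, d) \<in> A}). w d)"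
      by (simp add: sum.reindex case_prod_beta)
    also have "\<dots> = (\<Sum>d=1..<n. \<Sum>x\<in>{x\<in>{1..n}. u (x, d) \<in> A}. w d)"
      by (subst sum.Sigma) auto
    also have "\<dots> = (\<Sum>d=1..<n. real (card {x\<in>{1..n}. u (x, d) \<in> A}) * w d)"
      by simp
    also have "\<dots> \<le> (\<Sum>d=1..<n. real (card A) * w d)"
    proof (intro sum_mono mult_right_mono w_nonneg)
      fix d assume d: "d \<in> {1..<n}"
      have "card {x\<in>{1..n}. u (x, d) \<in> A} \<le> card A"
        using finite_subset[OF A]
        by (intro card_inj_on_le[of "\<lambda>x. u (x, d)"] inj_on_subset[OF inj[OF d]]) auto
      then show "real (card {x\<in>{1..n}. u (x, d) \<in> A}) \<le> real (card A)" by simp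
    qed
    also have "\<dots> = real (card A) * (\<Sum>d=1..<n. w d)" by (simp add: sum_distrib_left)
    also have "(\<Sum>d=1..<n. w d) = 1 / real n" using sum_w n by (simp add: field_simps)
    finally show ?thesis by simp
  qed
  show thesis
  proof (rule that[of D])
    show "set_pmf D \<subseteq> {1..n} \<times> {1..n}"
      using set_E y_in by (auto simp: D_def I_def)
  next
    fix A assume A: "A \<subseteq> {1..n}"
    have "measure_pmf.prob D {(x, y). x \<in> A \<or> y \<in> A} =
        measure_pmf.prob E ({p. fst p \<in> A} \<union> {p. y p \<in> A})"
      unfolding D_def measure_map_pmf by (intro arg_cong2[of _ _ _ _ measure]) auto
    also have "\<dots> \<le> measure_pmf.prob E {p. fst p \<in> A} + measure_pmf.prob E {p. y p \<in> A}"
      by (intro measure_Un_le) auto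
    also have "\<dots> \<le> real (card A) / real n + real (card A) / real n"
      unfolding prob_E
    proof (intro add_mono uniform A)
      fix d assume "d \<in> {1..<n}"
      show "inj_on (\<lambda>x. fst (x, d)) {1..n}" by simp
      show "inj_on (\<lambda>x. y (x, d)) {1..n}"
        by (intro inj_onI) (auto simp: y_def split: if_splits)
    qed
    finally show "measure_pmf.prob D {(x, y). x \<in> A \<or> y \<in> A} \<le> 2 * real (card A) / real n"
      by simp
  next
    fix \<epsilon> P f
    assume far: "local_property n P" "f \<in> sequences n" "\<epsilon> \<le> 1" "eps_far n \<epsilon> P f"
    define V where "V = violations n P f"
    define X where "X = {p. \<not> consistent_at P f (fst p) (y p)}"
    have "\<epsilon> / (4 * harm (n - 1)) = (\<epsilon> * real n / 4) / (real n * H)"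
      using n by (simp add: H_def)
    also have "\<dots> \<le> (\<Sum>(x, z)\<in>V. 1 / (real z - real x)) / (real n * H)"
      unfolding V_def using eps_far_violation_sum[OF far(1) n far(2-4)] H
      by (intro divide_right_mono) auto
    also have "\<dots> = (\<Sum>(x, z)\<in>V. w (z - x))"
      unfolding sum_divide_distrib w_def
      by (intro sum.cong) (auto simp: V_def violations_def of_nat_diff field_simps)
    also have "\<dots> = (\<Sum>(x, d)\<in>(\<lambda>(x, z). (x, z - x)) ` V. w d)"
      by (subst sum.reindex) (auto simp: inj_on_def V_def violations_def case_prod_beta)
    \<comment> \<open>The pairs without wrap-around suffice: a violation \<open>(x, z)\<close> is
      reached by \<open>d = z - x\<close>.\<close>
    also have "\<dots> \<le> (\<Sum>(x, d)\<in>X \<inter> I. w d)"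
      using fin by (intro sum_mono2) (auto simp: w_nonneg X_def I_def V_def violations_def y_def)
    also have "\<dots> = measure_pmf.prob D {(x, y). \<not> consistent_at P f x y}"
      unfolding D_def measure_map_pmf prob_E[symmetric] X_def by (intro arg_cong2[of _ _ _ _ measure]) auto
    finally show "measure_pmf.prob D {(x, y). \<not> consistent_at P f x y} \<ge> \<epsilon> / (4 * harm (n - 1))" .
  qed
qed

subsection \<open>Testing pairs against an online adversary\<close>

definition modified :: "nat \<Rightarrow> (nat \<Rightarrow> real) \<Rightarrow> strategy \<Rightarrow> nat list \<Rightarrow> nat set" where
  "modified n f S xs = {v\<in>{1..n}. S xs v \<noteq> Some (f v)}"

lemma modified_subset: "modified n f S xs \<subseteq> {1..n}"
  by (auto simp: modified_def)

text \<open>The budgets of the single steps telescope, starting from the first oracle, which is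
  exact.\<close>

lemma card_modified:
  assumes S: "fixed_rate_strategy n t f S" and t: "t \<ge> 0" and xs: "xs \<in> lists {1..n}"
  shows "int (card (modified n f S xs)) \<le> \<lfloor>real (length xs + 1) * t\<rfloor>"
  using xs
proof (induction xs rule: rev_induct)
  case Nil
  have "modified n f S [] = {}"
    using S by (auto simp: modified_def fixed_rate_strategy_def)
  then show ?case using t by simp
next
  case (snoc x xs)
  have "modified n f S (xs @ [x]) \<subseteq>
      modified n f S xs \<union> {v\<in>{1..n}. S xs v \<noteq> S (xs @ [x]) v}"
    by (auto simp: modified_def)
  then have "card (modified n f S (xs @ [x])) \<le>
      card (modified n f S xs) + Dist n (S xs) (S (xs @ [x]))"
    unfolding Dist_def by (intro order_trans[OF card_mono card_Un_le]) (auto simp: modified_def)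
  moreover have "int (Dist n (S xs) (S (xs @ [x]))) \<le>
      \<lfloor>real (length xs + 1 + 1) * t\<rfloor> - \<lfloor>real (length xs + 1) * t\<rfloor>"
    using S snoc.prems by (auto simp: fixed_rate_strategy_def Let_def)
  ultimately show ?case
    using snoc by simp
qed

lemma fixed_rate_no_change:
  assumes S: "fixed_rate_strategy n t f S" and xs: "xs \<in> lists {1..n}" "x \<in> {1..n}"
    and "\<lfloor>real (length xs + 2) * t\<rfloor> = \<lfloor>real (length xs + 1) * t\<rfloor>" and v: "v \<in> {1..n}"
  shows "S (xs @ [x]) v = S xs v"
proof -
  have "int (Dist n (S xs) (S (xs @ [x]))) \<le>
      \<lfloor>real (length xs + 1 + 1) * t\<rfloor> - \<lfloor>real (length xs + 1) * t\<rfloor>"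
    using S xs by (auto simp: fixed_rate_strategy_def Let_def)
  then have "Dist n (S xs) (S (xs @ [x])) = 0"
    using assms(4) by (simp add: numeral_2_eq_2)
  then have "{v\<in>{1..n}. S xs v \<noteq> S (xs @ [x]) v} = {}"
    by (simp add: Dist_def)
  then show ?thesis using v by (metis (mono_tags, lifting) empty_iff mem_Collect_eq)
qed

lemma erasure_strategy_answer:
  assumes S: "S \<in> erasure_strategies n t f" and "xs \<in> lists {1..n}" "v \<in> {1..n}"
  shows "S xs v \<in> {Some (f v), None}"
  using assms(2)
proof (induction xs rule: rev_induct)
  case Nil
  then show ?case
    using S assms(3) by (auto simp: erasure_strategies_def fixed_rate_strategy_def)
next
  case (snoc x xs)
  then have "S (xs @ [x]) v \<in> {S xs v, None}"
    using S assms(3) by (auto simp: erasure_strategies_def)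
  then show ?case using snoc by auto
qed

text \<open>Otherwise the floor grows by 1 at each of \<open>B - 1\<close> steps, while its argument
  grows by \<open>(B - 1) * t\<close> in all. As a floor loses less than 1, this forces
  \<open>(B - 1) * (1 - t) < 1\<close>. The bound \<open>j + 2 \<le> B\<close> leaves room for both
  queries of a pair in a block.\<close>

lemma quiet_step_exists:
  fixes t :: real
  assumes t: "0 < t" "t < 1" and B: "real B \<ge> 1 / (1 - t) + 1"
  shows "\<exists>j. j + 2 \<le> B \<and> \<lfloor>real (l + j + 2) * t\<rfloor> = \<lfloor>real (l + j + 1) * t\<rfloor>"
proof (rule ccontr)
  assume no: "\<not> ?thesis"
  have step: "\<lfloor>real (l + j + 1) * t\<rfloor> + 1 \<le> \<lfloor>real (l + j + 2) * t\<rfloor>" if "j + 2 \<le> B" for j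
  proof -
    have "\<lfloor>real (l + j + 1) * t\<rfloor> \<le> \<lfloor>real (l + j + 2) * t\<rfloor>"
      using t by (intro floor_mono mult_right_mono) auto
    then show ?thesis using no that by fastforce
  qed
  have steps: "\<lfloor>real (l + 1) * t\<rfloor> + int j \<le> \<lfloor>real (l + j + 1) * t\<rfloor>" if "j + 1 \<le> B" for j
    using that
  proof (induction j)
    case (Suc j)
    then show ?case using step[of j] by (simp add: numeral_2_eq_2)
  qed simp
  have B1: "B \<ge> 1"
    using B t by (cases B) (auto simp: field_simps)
  then have "\<lfloor>real (l + 1) * t\<rfloor> + int (B - 1) \<le> \<lfloor>real (l + (B - 1) + 1) * t\<rfloor>"
    by (intro steps) simp
  then have "real (l + 1) * t - 1 + real (B - 1) < real (l + (B - 1) + 1) * t"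
    by linarith
  then have "real (B - 1) * (1 - t) < 1"
    by (simp add: algebra_simps)
  moreover have "1 / (1 - t) * (1 - t) \<le> real (B - 1) * (1 - t)"
    using B B1 t by (intro mult_right_mono) (auto simp: of_nat_diff)
  ultimately show False using t by simp
qed

text \<open>Conditioning on the first draw. In the analysis \<open>X\<close> holds the pairs for
  which the current block may err, and \<open>g x\<close> is the rest of the run.\<close>

lemma prob_bind_pmf_le:
  assumes "\<And>x. x \<in> set_pmf D \<Longrightarrow> measure_pmf.prob (g x) A \<le> a * indicator X x + c"
  shows "measure_pmf.prob (bind_pmf D g) A \<le> a * measure_pmf.prob D X + c"
proof -
  have ind: "integrable (measure_pmf D) (\<lambda>x. a * indicat_real X x)"
    by (intro integrable_mult_right measure_pmf.integrable_const_bound[where B = 1]) auto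
  have "measure_pmf.prob (bind_pmf D g) A = (\<integral>x. measure_pmf.prob (g x) A \<partial>measure_pmf D)"
    unfolding measure_pmf_bind using measurable_measure_pmf[of g]
    by (intro measure_pmf.measure_bind[where N = "count_space UNIV"]) auto
  also have "\<dots> \<le> (\<integral>x. a * indicator X x + c \<partial>measure_pmf D)"
  proof (intro integral_mono_AE)
    show "integrable (measure_pmf D) (\<lambda>x. measure_pmf.prob (g x) A)"
      by (intro measure_pmf.integrable_const_bound[where B = 1]) auto
    show "integrable (measure_pmf D) (\<lambda>x. a * indicator X x + c)"
      using ind by (intro Bochner_Integration.integrable_add) auto
  qed (use assms in \<open>auto simp: AE_measure_pmf_iff\<close>)
  also have "\<dots> = a * measure_pmf.prob D X + c"
    using ind by (subst Bochner_Integration.integral_add) auto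
  finally show ?thesis .
qed

section \<open>The pair tester\<close>

primrec dummy_queries :: "nat \<Rightarrow> decision_tree \<Rightarrow> decision_tree" where
  "dummy_queries 0 d = d"
| "dummy_queries (Suc m) d = Query 1 (\<lambda>_. dummy_queries m d)"

lemma accepts_dummy_queries:
  "accepts (dummy_queries m d) S h \<longleftrightarrow> accepts d S (h @ replicate m 1)"
  by (induction m arbitrary: h) (simp_all add: replicate_app_Cons_same)

lemma queries_within_dummy_queries:
  "n \<ge> 1 \<Longrightarrow> queries_within n d \<Longrightarrow> queries_within n (dummy_queries m d)"
  by (induction m) auto

lemma depth_dummy_queries:
  "depth_at_most d q \<Longrightarrow> depth_at_most (dummy_queries m d) (m + q)"
  by (induction m) auto

text \<open>A missing answer never refutes; this is what gives one-sided error under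
  erasures.\<close>

definition refutes :: "(nat \<Rightarrow> real) set \<Rightarrow> nat \<Rightarrow> nat \<Rightarrow> real option \<Rightarrow> real option \<Rightarrow> bool" where
  "refutes P x y a b \<longleftrightarrow>
     (\<exists>u v. a = Some u \<and> b = Some v \<and> \<not> (\<exists>g\<in>P. g x = u \<and> g y = v))"

lemma refutes_Some [simp]:
  "refutes P x y (Some (f x)) (Some (f y)) \<longleftrightarrow> \<not> consistent_at P f x y"
  by (simp add: refutes_def consistent_at_def)

text \<open>The first dummies move the pair to a quiet step. The last ones pad an unrejected block
  to exactly \<open>B\<close> queries, so the next block starts at a step known in advance.\<close>

definition pair_block ::
  "(nat \<Rightarrow> real) set \<Rightarrow> nat \<Rightarrow> nat \<Rightarrow> nat \<times> nat \<Rightarrow> decision_tree \<Rightarrow> decision_tree" where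
  "pair_block P B j p d = dummy_queries j (Query (fst p) (\<lambda>a. Query (snd p) (\<lambda>b.
     if refutes P (fst p) (snd p) a b then Reject else dummy_queries (B - 2 - j) d)))"

text \<open>The argument \<open>l\<close> is the number of queries made before, which determines the steps at which a
  fixed-rate adversary has to stay idle.\<close>

primrec pair_tester ::
  "(nat \<Rightarrow> real) set \<Rightarrow> nat \<Rightarrow> (nat \<Rightarrow> nat) \<Rightarrow> (nat \<times> nat) pmf \<Rightarrow> nat \<Rightarrow> nat \<Rightarrow> randomized_algorithm"
where
  "pair_tester P B off D 0 l = return_pmf Accept"
| "pair_tester P B off D (Suc m) l =
     bind_pmf D (\<lambda>p. map_pmf (pair_block P B (off l) p) (pair_tester P B off D m (l + B)))"

text \<open>The offsets come from \<open>quiet_step_exists\<close> and \<open>D\<close> from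
  \<open>violating_pair_distribution\<close>. Only the chance of hitting a given set is assumed of
  \<open>D\<close> here; the chance of an inconsistent pair enters later as
  \<open>\<rho>\<close>.\<close>

locale quiet_pairs =
  fixes n :: nat and t :: real and P :: "(nat \<Rightarrow> real) set"
    and B :: nat and off :: "nat \<Rightarrow> nat" and D :: "(nat \<times> nat) pmf"
  assumes n: "n \<ge> 1" and t: "0 < t" "t < 1"
    and off: "\<And>l. off l + 2 \<le> B"
      "\<And>l. \<lfloor>real (l + off l + 2) * t\<rfloor> = \<lfloor>real (l + off l + 1) * t\<rfloor>"
    and set_D: "set_pmf D \<subseteq> {1..n} \<times> {1..n}"
    and hit: "\<And>A. A \<subseteq> {1..n} \<Longrightarrow>
      measure_pmf.prob D {(x, y). x \<in> A \<or> y \<in> A} \<le> 2 * real (card A) / real n"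
begin

abbreviation tester :: "nat \<Rightarrow> nat \<Rightarrow> randomized_algorithm" where
  "tester \<equiv> pair_tester P B off D"

lemma queries_within_tester: "d \<in> set_pmf (tester m l) \<Longrightarrow> queries_within n d"
proof (induction m arbitrary: l d)
  case (Suc m)
  then obtain p d' where "p \<in> set_pmf D" "d' \<in> set_pmf (tester m (l + B))"
    "d = pair_block P B (off l) p d'" by auto
  moreover from this(1) have "fst p \<in> {1..n}" "snd p \<in> {1..n}"
    using set_D by (auto simp: mem_Times_iff)
  ultimately show ?case
    using Suc.IH n
    by (auto simp: pair_block_def intro!: queries_within_dummy_queries)
qed simp

lemma depth_tester: "d \<in> set_pmf (tester m l) \<Longrightarrow> depth_at_most d (m * B)"
proof (induction m arbitrary: l d)
  case (Suc m)
  then obtain p d' where d': "d' \<in> set_pmf (tester m (l + B))"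
    "d = pair_block P B (off l) p d'" by auto
  have "depth_at_most (dummy_queries (B - 2 - off l) d') ((B - 2 - off l) + m * B)"
    using Suc.IH d' by (intro depth_dummy_queries) auto
  then have "depth_at_most d (off l + Suc (Suc ((B - 2 - off l) + m * B)))"
    unfolding d' pair_block_def by (intro depth_dummy_queries) simp
  moreover have "off l + Suc (Suc ((B - 2 - off l) + m * B)) = Suc m * B"
    using off(1)[of l] by simp
  ultimately show ?case by metis
qed simp

lemma makes_at_most_tester: "makes_at_most (m * B) (tester m l)"
  using depth_tester by (auto simp: makes_at_most_def)

text \<open>\<open>h1\<close> and \<open>h2\<close> are the histories at the two queries of the
  pair, \<open>h3\<close> the one after the block. None depends on the answers, so an induction over
  blocks can continue from \<open>h3\<close>.\<close>

lemma block_history: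
  assumes "h \<in> lists {1..n}" "p \<in> set_pmf D"
  defines "h1 \<equiv> h @ replicate (off (length h)) 1"
  defines "h2 \<equiv> h1 @ [fst p]"
  defines "h3 \<equiv> h2 @ snd p # replicate (B - 2 - off (length h)) 1"
  shows "h1 \<in> lists {1..n}" "h2 \<in> lists {1..n}" "h3 \<in> lists {1..n}"
    and "length h3 = length h + B"
    and "accepts (pair_block P B (off (length h)) p d) S h \<longleftrightarrow>
      \<not> refutes P (fst p) (snd p) (S h1 (fst p)) (S h2 (snd p)) \<and> accepts d S h3"
  using assms set_D n off(1)[of "length h"]
  by (auto simp: pair_block_def accepts_dummy_queries)

text \<open>The adversary sees the first end of the pair before the second is queried, but the quiet
  step keeps it from reacting. Hence the modified set at \<open>h1\<close>, fixed before the pair is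
  drawn, governs both answers.\<close>

lemma block_unmodified:
  assumes S: "fixed_rate_strategy n t f S" and h: "h \<in> lists {1..n}" and p: "p \<in> set_pmf D"
  defines "h1 \<equiv> h @ replicate (off (length h)) 1"
  defines "h3 \<equiv> (h1 @ [fst p]) @ snd p # replicate (B - 2 - off (length h)) 1"
  assumes "p \<notin> {(x, y). x \<in> modified n f S h1 \<or> y \<in> modified n f S h1}"
  shows "accepts (pair_block P B (off (length h)) p d) S h \<longleftrightarrow>
    consistent_at P f (fst p) (snd p) \<and> accepts d S h3"
proof -
  note hist = block_history[OF h p, folded h1_def, folded h3_def]
  have p_in: "fst p \<in> {1..n}" "snd p \<in> {1..n}"
    using p set_D by (auto simp: mem_Times_iff)
  have "S (h1 @ [fst p]) (snd p) = S h1 (snd p)"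
    using off(2)[of "length h"] hist(1) p_in
    by (intro fixed_rate_no_change[OF S]) (auto simp: h1_def algebra_simps)
  moreover have "S h1 (fst p) = Some (f (fst p))" "S h1 (snd p) = Some (f (snd p))"
    using assms(6) p_in by (auto simp: modified_def split_beta)
  ultimately show ?thesis
    using hist(5)[of d S] by simp
qed

section \<open>Error probabilities of the pair tester\<close>

lemma prob_hits_modified:
  assumes S: "fixed_rate_strategy n t f S" and h: "h \<in> lists {1..n}" "length h < q"
  shows "measure_pmf.prob D {(x, y). x \<in> modified n f S h \<or> y \<in> modified n f S h} \<le>
    2 * real q / real n"
proof -
  have "int (card (modified n f S h)) \<le> \<lfloor>real (length h + 1) * t\<rfloor>"
    using t by (intro card_modified[OF S] h) simp
  also have "\<dots> \<le> \<lfloor>real (length h + 1)\<rfloor>"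
    using t by (intro floor_mono mult_left_le) auto
  finally have "card (modified n f S h) \<le> q"
    using h by simp
  then have "2 * real (card (modified n f S h)) / real n \<le> 2 * real q / real n"
    by (intro divide_right_mono) auto
  then show ?thesis
    using hit[OF modified_subset] order_trans by blast
qed

text \<open>A union bound over the blocks: a member has no inconsistent pairs, so a block rejects
  only if its pair hits a modified position.\<close>

lemma prob_rejects_member:
  assumes S: "fixed_rate_strategy n t f S" and f: "f \<in> P"
    and "h \<in> lists {1..n}" "length h + m * B \<le> q"
  shows "measure_pmf.prob (tester m (length h)) {d. \<not> accepts d S h} \<le>
    real m * (2 * real q / real n)"
  using assms(3,4)
proof (induction m arbitrary: h)
  case (Suc m)
  define h1 where "h1 = h @ replicate (off (length h)) 1"
  define X where "X = {(x, y). x \<in> modified n f S h1 \<or> y \<in> modified n f S h1}"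
  have "measure_pmf.prob (tester (Suc m) (length h)) {d. \<not> accepts d S h} \<le>
      1 * measure_pmf.prob D X + real m * (2 * real q / real n)"
    unfolding pair_tester.simps
  proof (rule prob_bind_pmf_le)
    fix p assume p: "p \<in> set_pmf D"
    note hist = block_history[OF Suc.prems(1) p, folded h1_def]
    let ?h3 = "(h1 @ [fst p]) @ snd p # replicate (B - 2 - off (length h)) 1"
    show "measure_pmf.prob (map_pmf (pair_block P B (off (length h)) p) (tester m (length h + B)))
        {d. \<not> accepts d S h} \<le> 1 * indicator X p + real m * (2 * real q / real n)"
    proof (cases "p \<in> X")
      case True
      have "0 \<le> real m * (2 * real q / real n)" by simp
      then show ?thesis
        using True by (simp add: add_increasing2)
    next
      case False
      have "consistent_at P f (fst p) (snd p)"
        using f by (auto simp: consistent_at_def)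
      then have "pair_block P B (off (length h)) p -` {d. \<not> accepts d S h} = {d. \<not> accepts d S ?h3}"
        using block_unmodified[OF S Suc.prems(1) p] False by (auto simp: h1_def X_def)
      then show ?thesis
        using Suc.IH[OF hist(3)] hist(4) Suc.prems(2) False by (simp add: measure_map_pmf)
    qed
  qed
  moreover have "measure_pmf.prob D X \<le> 2 * real q / real n"
    unfolding X_def
  proof (rule prob_hits_modified[OF S])
    show "h1 \<in> lists {1..n}" using Suc.prems(1) n by (auto simp: h1_def)
    show "length h1 < q" using Suc.prems(2) off(1)[of "length h"] by (simp add: h1_def)
  qed
  ultimately show ?case
    by (simp only: of_nat_Suc distrib_right mult_1)
qed simp

text \<open>Whatever the past, a block lets the input pass only if its fresh pair is consistent or
  hits a modified position. These conditional bounds multiply over the blocks.\<close>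

lemma prob_accepts_far:
  assumes S: "fixed_rate_strategy n t f S"
    and \<rho>: "measure_pmf.prob D {(x, y). \<not> consistent_at P f x y} \<ge> \<rho>"
    and "h \<in> lists {1..n}" "length h + m * B \<le> q"
  shows "measure_pmf.prob (tester m (length h)) {d. accepts d S h} \<le>
    (1 - \<rho> + 2 * real q / real n) ^ m"
  using assms(3,4)
proof (induction m arbitrary: h)
  case (Suc m)
  let ?c = "1 - \<rho> + 2 * real q / real n"
  define h1 where "h1 = h @ replicate (off (length h)) 1"
  define X where "X = {(x, y). x \<in> modified n f S h1 \<or> y \<in> modified n f S h1}"
  define V where "V = {(x, y). \<not> consistent_at P f x y}"
  have "\<rho> \<le> 1" using \<rho> measure_pmf.prob_le_1 order_trans by blast
  then have c: "?c \<ge> 0" by simp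
  have "measure_pmf.prob (tester (Suc m) (length h)) {d. accepts d S h} \<le>
      ?c ^ m * measure_pmf.prob D (- V \<union> X) + 0"
    unfolding pair_tester.simps
  proof (rule prob_bind_pmf_le)
    fix p assume p: "p \<in> set_pmf D"
    note hist = block_history[OF Suc.prems(1) p, folded h1_def]
    let ?h3 = "(h1 @ [fst p]) @ snd p # replicate (B - 2 - off (length h)) 1"
    have "measure_pmf.prob (tester m (length h + B))
        (pair_block P B (off (length h)) p -` {d. accepts d S h}) \<le>
        measure_pmf.prob (tester m (length h + B)) {d. accepts d S ?h3}"
      using hist(5) by (intro measure_pmf.finite_measure_mono) auto
    also have "\<dots> \<le> ?c ^ m"
      using Suc.IH[OF hist(3)] hist(4) Suc.prems(2) by simp
    finally have le: "measure_pmf.prob (tester m (length h + B))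
        (pair_block P B (off (length h)) p -` {d. accepts d S h}) \<le> ?c ^ m" .
    show "measure_pmf.prob (map_pmf (pair_block P B (off (length h)) p) (tester m (length h + B)))
        {d. accepts d S h} \<le> ?c ^ m * indicator (- V \<union> X) p + 0"
    proof (cases "p \<in> - V \<union> X")
      case True
      then show ?thesis
        using le by (simp add: measure_map_pmf)
    next
      case False
      then have "pair_block P B (off (length h)) p -` {d. accepts d S h} = {}"
        using block_unmodified[OF S Suc.prems(1) p] by (auto simp: h1_def X_def V_def)
      then show ?thesis
        using False by (simp add: measure_map_pmf)
    qed
  qed
  also have "\<dots> \<le> ?c ^ Suc m"
  proof -
    have "measure_pmf.prob D (- V \<union> X) \<le> ?c"
  proof -
    have "measure_pmf.prob D (- V \<union> X) \<le> measure_pmf.prob D (- V) + measure_pmf.prob D X"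
      by (intro measure_Un_le) auto
    also have "measure_pmf.prob D (- V) = 1 - measure_pmf.prob D V"
      using measure_pmf.prob_compl[of V D] by (simp add: Compl_eq_Diff_UNIV)
    also have "measure_pmf.prob D X \<le> 2 * real q / real n"
      unfolding X_def
    proof (rule prob_hits_modified[OF S])
      show "h1 \<in> lists {1..n}" using Suc.prems(1) n by (auto simp: h1_def)
      show "length h1 < q" using Suc.prems(2) off(1)[of "length h"] by (simp add: h1_def)
    qed
    finally show ?thesis using \<rho> by (simp add: V_def)
  qed
  from mult_left_mono[OF this zero_le_power[OF c]]
  show ?thesis by (simp add: mult.commute)
  qed
  finally show ?case .
qed simp

text \<open>Every answer that is not erased is a true value, so \<open>f\<close> itself is a member
  of \<open>P\<close> matching both answers.\<close>

lemma one_sided_tester: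
  assumes S: "S \<in> erasure_strategies n t f" and f: "f \<in> P"
    and "h \<in> lists {1..n}" "d \<in> set_pmf (tester m (length h))"
  shows "accepts d S h"
  using assms(3,4)
proof (induction m arbitrary: h d)
  case (Suc m)
  then obtain p d' where p: "p \<in> set_pmf D" and d': "d' \<in> set_pmf (tester m (length h + B))"
    and d: "d = pair_block P B (off (length h)) p d'" by auto
  note hist = block_history[OF Suc.prems(1) p]
  have "\<not> refutes P (fst p) (snd p) a b"
    if "a \<in> {Some (f (fst p)), None}" "b \<in> {Some (f (snd p)), None}" for a b
    using that f by (auto simp: refutes_def)
  moreover have "fst p \<in> {1..n}" "snd p \<in> {1..n}"
    using p set_D by (auto simp: mem_Times_iff)
  ultimately show ?case
    unfolding d hist(5) using erasure_strategy_answer[OF S] hist(1,2)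
    by (intro conjI Suc.IH[OF hist(3)]) (blast, simp only: hist(4) d')
qed simp

end

subsection \<open>Choice of parameters\<close>

lemma eps_far_not_member:
  assumes "\<epsilon> > 0" "n \<ge> 1" "eps_far n \<epsilon> P f"
  shows "f \<notin> P"
proof
  assume "f \<in> P"
  then have "\<epsilon> * real n \<le> real (Dist n f f)"
    using assms(3) unfolding eps_far_def by blast
  then show False using assms(1,2) by (auto simp: Dist_def mult_le_0_iff)
qed

primrec read_all :: "(nat \<Rightarrow> real) set \<Rightarrow> nat list \<Rightarrow> (nat \<Rightarrow> real) \<Rightarrow> decision_tree" where
  "read_all P [] g = (if g \<in> P then Accept else Reject)"
| "read_all P (x # xs) g = Query x (\<lambda>a. read_all P xs (g(x := the a)))"

lemma accepts_read_all:
  assumes "\<And>k. k < length xs \<Longrightarrow> S (h @ take k xs) (xs ! k) = Some (f (xs ! k))"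
  shows "accepts (read_all P xs g) S h \<longleftrightarrow> (\<lambda>x. if x \<in> set xs then f x else g x) \<in> P"
  using assms
proof (induction xs arbitrary: h g)
  case (Cons x xs)
  have "S h x = Some (f x)"
    using Cons.prems[of 0] by simp
  moreover have "S ((h @ [x]) @ take k xs) (xs ! k) = Some (f (xs ! k))" if "k < length xs" for k
    using Cons.prems[of "Suc k"] that by simp
  from Cons.IH[OF this] have "accepts (read_all P xs (g(x := f x))) S (h @ [x]) \<longleftrightarrow>
      (\<lambda>y. if y \<in> set xs then f y else (g(x := f x)) y) \<in> P" .
  moreover have "(\<lambda>y. if y \<in> set xs then f y else (g(x := f x)) y) =
      (\<lambda>y. if y \<in> set (x # xs) then f y else g y)"
    by auto
  ultimately show ?case by simp
qed simp

lemma queries_within_read_all: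
  "set xs \<subseteq> {1..n} \<Longrightarrow> queries_within n (read_all P xs g)"
  by (induction xs arbitrary: g) auto

lemma depth_read_all: "depth_at_most (read_all P xs g) (length xs)"
  by (induction xs arbitrary: g) auto

text \<open>As \<open>n * t < 1\<close>, all the floors up to index \<open>n\<close> vanish, so the
  first \<open>n\<close> queries are answered truthfully. A single deterministic tree then decides
  membership against any such adversary.\<close>

lemma exact_tester:
  assumes n: "n \<ge> 1" and t: "0 < t" "real n * t < 1" and "\<epsilon> > 0" and P: "P \<subseteq> sequences n"
  obtains T where "makes_at_most n T"
    "\<And>Adv. (\<And>f S. S \<in> Adv f \<Longrightarrow> fixed_rate_strategy n t f S) \<Longrightarrow>
      eps_tester n \<epsilon> P Adv T \<and> one_sided_error P Adv T"
proof -
  \<comment> \<open>Starting from \<open>undefined\<close> makes the function read extensional, as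
    members of \<open>sequences n\<close> are.\<close>
  define d where "d = read_all P [1..<Suc n] (\<lambda>_. undefined)"
  have acc: "accepts d S [] \<longleftrightarrow> f \<in> P" if f: "f \<in> sequences n" and S: "fixed_rate_strategy n t f S" for f S
  proof -
    have unmodified: "S xs v = Some (f v)" if xs: "xs \<in> lists {1..n}" "length xs < n" and v: "v \<in> {1..n}" for xs v
    proof -
      have "int (card (modified n f S xs)) \<le> \<lfloor>real (length xs + 1) * t\<rfloor>"
        using t by (intro card_modified[OF S] xs) simp
      also have "real (length xs + 1) * t \<le> real n * t"
        using xs t by (intro mult_right_mono) auto
      then have "\<lfloor>real (length xs + 1) * t\<rfloor> \<le> 0"
        using t by linarith
      finally have "modified n f S xs = {}"
        using finite_subset[OF modified_subset[of n f S xs]] by simp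
      then show ?thesis using v by (auto simp: modified_def)
    qed
    have "accepts d S [] \<longleftrightarrow> (\<lambda>x. if x \<in> set [1..<Suc n] then f x else undefined) \<in> P"
      unfolding d_def
    proof (intro accepts_read_all)
      fix k assume k: "k < length [1..<Suc n]"
      have "set (take k [1..<Suc n]) \<subseteq> {1..n}"
        using set_take_subset[of k "[1..<Suc n]"] by auto
      then have "take k [1..<Suc n] \<in> lists {1..n}"
        by (simp only: lists_eq_set mem_Collect_eq)
      then show "S ([] @ take k [1..<Suc n]) ([1..<Suc n] ! k) = Some (f ([1..<Suc n] ! k))"
        using k by (simp only: append_Nil) (intro unmodified; simp del: upt_Suc)
    qed
    also have "(\<lambda>x. if x \<in> set [1..<Suc n] then f x else undefined) = f"
      using f by (auto simp: sequences_def PiE_def extensional_def fun_eq_iff)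
    finally show ?thesis .
  qed
  have q: "queries_within n d"
    unfolding d_def by (intro queries_within_read_all) auto
  show thesis
  proof (rule that[of "return_pmf d"])
    have "depth_at_most d n"
      using depth_read_all[of P "[1..<Suc n]"] by (simp add: d_def del: upt_Suc)
    then show "makes_at_most n (return_pmf d)"
      by (simp add: makes_at_most_def)
    fix Adv assume "\<And>f S. S \<in> Adv f \<Longrightarrow> fixed_rate_strategy n t f S"
    then show "eps_tester n \<epsilon> P Adv (return_pmf d) \<and> one_sided_error P Adv (return_pmf d)"
      using acc q P eps_far_not_member[OF \<open>\<epsilon> > 0\<close> n]
      by (auto simp: eps_tester_def one_sided_error_def indicator_def subset_iff)
  qed
qed

text \<open>With one position there are no adjacent pairs, so every sequence belongs to
  \<open>P\<close>.\<close>

lemma trivial_tester: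
  assumes "local_property 1 P" "\<epsilon> > 0"
  shows "eps_tester 1 \<epsilon> P Adv (return_pmf Accept) \<and> one_sided_error P Adv (return_pmf Accept) \<and>
    makes_at_most 0 (return_pmf Accept)"
proof -
  have "f \<in> P" if "f \<in> sequences 1" for f
    using assms(1) that unfolding local_property_def by auto
  then have "\<not> eps_far 1 \<epsilon> P f" if "f \<in> sequences 1" for f
    using that eps_far_not_member[OF assms(2)] by blast
  then show ?thesis
    by (auto simp: eps_tester_def one_sided_error_def makes_at_most_def)
qed

section \<open>The pair tester on long inputs\<close>

lemma long_input_tester:
  fixes \<epsilon> t :: real
  assumes n: "n \<ge> 2" and \<epsilon>: "0 < \<epsilon>" "\<epsilon> < 1" and t: "0 < t" "t < 1" and loc: "local_property n P"
    and large: "2916 * (1 + ln (real n))\<^sup>2 \<le> real n * \<epsilon>\<^sup>2 * (1 - t)"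
  obtains T q where "eps_tester n \<epsilon> P (erasure_strategies n t) T"
    "one_sided_error P (erasure_strategies n t) T"
    "eps_tester n \<epsilon> P (corruption_strategies n t) T"
    "makes_at_most q T" "real q \<le> 27 * (1 + ln (real n)) / (\<epsilon> * (1 - t))"
proof -
  define H :: real where "H = harm (n - 1)"
  define B where "B = nat \<lceil>1 / (1 - t)\<rceil> + 1"
  \<comment> \<open>The number of blocks is \<open>2 / \<rho>\<close> rounded up, which gives
    \<open>M * \<rho> \<ge> 2\<close>; \<open>\<beta>\<close> below bounds the chance that a block
    hits a modified position.\<close>
  define M where "M = nat \<lceil>8 * H / \<epsilon>\<rceil>"
  define q where "q = M * B"
  define \<rho> where "\<rho> = \<epsilon> / (4 * H)"
  define \<beta> where "\<beta> = 2 * real q / real n"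
  have "real B \<ge> 1 / (1 - t) + 1" by (simp add: B_def) linarith
  then obtain off where off: "\<And>l. off l + 2 \<le> B"
      "\<And>l. \<lfloor>real (l + off l + 2) * t\<rfloor> = \<lfloor>real (l + off l + 1) * t\<rfloor>"
    using quiet_step_exists[OF t] by metis
  obtain D where D: "set_pmf D \<subseteq> {1..n} \<times> {1..n}"
    "\<And>A. A \<subseteq> {1..n} \<Longrightarrow> measure_pmf.prob D {(x, y). x \<in> A \<or> y \<in> A} \<le> 2 * real (card A) / real n"
    "\<And>\<epsilon> P f. local_property n P \<Longrightarrow> f \<in> sequences n \<Longrightarrow> \<epsilon> \<le> 1 \<Longrightarrow> eps_far n \<epsilon> P f \<Longrightarrow>
       measure_pmf.prob D {(x, y). \<not> consistent_at P f x y} \<ge> \<epsilon> / (4 * harm (n - 1))"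
    using violating_pair_distribution[OF n] by blast
  have H1: "H \<ge> 1"
    using harm_mono[of 1 "n - 1", where 'a = real] n by (simp add: H_def harm_expand)
  have Hln: "H \<le> 1 + ln (real n)"
  proof -
    have "H \<le> ln (real (n - 1)) + 1"
      unfolding H_def using n by (intro harm_le_ln) simp
    also have "ln (real (n - 1)) \<le> ln (real n)"
      using n by (subst ln_le_cancel_iff) auto
    finally show ?thesis by simp
  qed
  interpret quiet_pairs n t P B off D
    using n t off D by unfold_locales auto
  have B3: "real B \<le> 3 / (1 - t)"
  proof -
    have "real B \<le> 1 / (1 - t) + 2" using t by (simp add: B_def) linarith
    also have "\<dots> \<le> 3 / (1 - t)" using t by (simp add: field_simps)
    finally show ?thesis .
  qed
  have M_ge: "real M \<ge> 8 * H / \<epsilon>" by (simp add: M_def) linarith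
  have M_le: "real M \<le> 9 * H / \<epsilon>"
  proof -
    have "real M \<le> 8 * H / \<epsilon> + 1" using \<epsilon> H1 by (simp add: M_def)
    also have "1 \<le> H / \<epsilon>" using \<epsilon> H1 by (simp add: field_simps)
    finally show ?thesis by (simp add: field_simps)
  qed
  have "real q \<le> (9 * H / \<epsilon>) * (3 / (1 - t))"
    unfolding q_def of_nat_mult using M_le B3 \<epsilon> H1 by (intro mult_mono) auto
  then have q_le: "real q \<le> 27 * H / (\<epsilon> * (1 - t))" by simp
  have \<beta>0: "\<beta> \<ge> 0" by (simp add: \<beta>_def)
  \<comment> \<open>Here \<open>M * q\<close> is at most \<open>9 * 27 = 243\<close> times
    \<open>H\<^sup>2 / (\<epsilon>\<^sup>2 * (1 - t))\<close>. The constant 2916 is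
    \<open>12 * 243\<close>, so \<open>M * q \<le> n / 12\<close>.\<close>
  have M\<beta>: "real M * \<beta> \<le> 1 / 6"
  proof -
    have "real M * real q \<le> (9 * H / \<epsilon>) * (27 * H / (\<epsilon> * (1 - t)))"
      using M_le q_le \<epsilon> H1 by (intro mult_mono) auto
    also have "\<dots> = 243 * H\<^sup>2 / (\<epsilon>\<^sup>2 * (1 - t))"
      by (simp add: power2_eq_square)
    also have "\<dots> \<le> 243 * (1 + ln (real n))\<^sup>2 / (\<epsilon>\<^sup>2 * (1 - t))"
      using Hln H1 t by (intro divide_right_mono mult_left_mono power_mono) auto
    also have "\<dots> \<le> real n / 12"
      using large \<epsilon> t by (simp add: field_simps)
    finally show ?thesis using n by (simp add: \<beta>_def field_simps)
  qed
  have M\<rho>: "real M * \<rho> \<ge> 2"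
  proof -
    have "2 = (8 * H / \<epsilon>) * \<rho>" using H1 \<epsilon> by (simp add: \<rho>_def)
    also have "\<dots> \<le> real M * \<rho>" using M_ge H1 \<epsilon> by (intro mult_right_mono) (auto simp: \<rho>_def)
    finally show ?thesis .
  qed
  have \<rho>1: "\<rho> \<le> 1" using H1 \<epsilon> by (simp add: \<rho>_def field_simps)
  have member: "measure_pmf.prob (tester M 0) {d. accepts d S []} \<ge> 2 / 3"
    if "f \<in> P" "fixed_rate_strategy n t f S" for f S
  proof -
    have "measure_pmf.prob (tester M 0) {d. \<not> accepts d S []} \<le> real M * \<beta>"
      using prob_rejects_member[OF that(2,1), of "[]" M q] by (simp add: q_def \<beta>_def)
    moreover have "measure_pmf.prob (tester M 0) {d. \<not> accepts d S []} =
        1 - measure_pmf.prob (tester M 0) {d. accepts d S []}"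
      using measure_pmf.prob_compl[of "{d. accepts d S []}" "tester M 0"]
      by (simp add: Compl_eq_Diff_UNIV[symmetric] Collect_neg_eq)
    ultimately show ?thesis using M\<beta> by simp
  qed
  have far: "measure_pmf.prob (tester M 0) {d. \<not> accepts d S []} \<ge> 2 / 3"
    if f: "f \<in> sequences n" "eps_far n \<epsilon> P f" and S: "fixed_rate_strategy n t f S" for f S
  proof -
    have "measure_pmf.prob D {(x, y). \<not> consistent_at P f x y} \<ge> \<rho>"
      using D(3)[OF loc f(1) _ f(2)] \<epsilon> by (simp add: \<rho>_def H_def)
    from prob_accepts_far[OF S this, of "[]" M q]
    have "measure_pmf.prob (tester M 0) {d. accepts d S []} \<le> (1 - \<rho> + \<beta>) ^ M"
      by (simp add: q_def \<beta>_def)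
    also have "\<dots> \<le> exp (\<beta> - \<rho>) ^ M"
      using \<rho>1 \<beta>0 exp_ge_add_one_self[of "\<beta> - \<rho>"] by (intro power_mono) (auto simp: algebra_simps)
    also have "\<dots> = exp (real M * (\<beta> - \<rho>))"
      by (simp add: exp_of_nat_mult)
    \<comment> \<open>The exponent is at most \<open>1 / 6 - 2\<close>.\<close>
    also have "\<dots> \<le> exp (- (11 / 6))"
      using M\<beta> M\<rho> by (simp add: algebra_simps)
    also have "\<dots> \<le> 1 / 3"
      using exp_lower_Taylor_quadratic[of "11 / 6"]
      by (simp add: exp_minus power2_eq_square field_simps)
    finally have "measure_pmf.prob (tester M 0) {d. accepts d S []} \<le> 1 / 3" .
    moreover have "measure_pmf.prob (tester M 0) {d. \<not> accepts d S []} =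
        1 - measure_pmf.prob (tester M 0) {d. accepts d S []}"
      using measure_pmf.prob_compl[of "{d. accepts d S []}" "tester M 0"]
      by (simp add: Compl_eq_Diff_UNIV[symmetric] Collect_neg_eq)
    ultimately show ?thesis by simp
  qed
  \<comment> \<open>The error bounds use only the rate condition, so one tester serves erasures and
    corruptions.\<close>
  have T: "eps_tester n \<epsilon> P Adv (tester M 0)"
    if "\<And>f S. S \<in> Adv f \<Longrightarrow> fixed_rate_strategy n t f S" for Adv
    unfolding eps_tester_def using that member far queries_within_tester by blast
  show thesis
  proof (rule that[of "tester M 0" q])
    show "eps_tester n \<epsilon> P (erasure_strategies n t) (tester M 0)"
      by (rule T) (simp add: erasure_strategies_def)
    show "eps_tester n \<epsilon> P (corruption_strategies n t) (tester M 0)"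
      by (rule T) (simp add: corruption_strategies_def)
    show "one_sided_error P (erasure_strategies n t) (tester M 0)"
      using one_sided_tester[of _ _ "[]"] by (auto simp: one_sided_error_def)
    show "makes_at_most q (tester M 0)"
      unfolding q_def by (rule makes_at_most_tester)
    have "27 * H / (\<epsilon> * (1 - t)) \<le> 27 * (1 + ln (real n)) / (\<epsilon> * (1 - t))"
      using Hln \<epsilon> t by (intro divide_right_mono) auto
    then show "real q \<le> 27 * (1 + ln (real n)) / (\<epsilon> * (1 - t))"
      using q_le by simp
  qed
qed

section \<open>Consequences of the bound on the input size\<close>

lemma ln_le_log2: "x \<ge> 1 \<Longrightarrow> ln x \<le> log 2 x"
  using ln_le_minus_one[of 2] by (simp add: log_def field_simps mult_left_le)

text \<open>The hypothesis bounds \<open>m\<close> by \<open>L\<close>, not by \<open>ln n\<close>.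
  But \<open>n = m / (\<epsilon>\<^sup>2 * (1 - t))\<close> gives
  \<open>ln n \<le> ln m + 2 * L\<close>, where \<open>ln m\<close> is small against the square root
  of \<open>m\<close>, and so is \<open>L\<close> by hypothesis.\<close>

lemma input_size_bounds:
  fixes \<epsilon> t :: real and n :: nat
  defines "L \<equiv> log 2 (1 / \<epsilon>) + log 2 (1 / (1 - t))"
  defines "m \<equiv> real n * \<epsilon>\<^sup>2 * (1 - t)"
  assumes \<epsilon>: "0 < \<epsilon>" "\<epsilon> < 1" and t: "0 < t" "t < 1"
    and n: "real n \<ge> 4 * 10 ^ 12" and nL: "10 ^ 40 * L\<^sup>2 \<le> m"
  shows "2916 * (1 + ln (real n))\<^sup>2 \<le> m" "m \<ge> 1"
proof -
  have L: "log 2 (1 / \<epsilon>) \<ge> 0" "log 2 (1 / (1 - t)) \<ge> 0"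
    using \<epsilon> t by simp_all
  have n0: "real n > 0" using n by simp
  have m0: "m > 0" using n0 \<epsilon> t by (simp add: m_def)
  have m_large: "m \<ge> 10 ^ 12"
  proof (cases "L \<ge> 1")
    case True
    then have "L\<^sup>2 \<ge> 1" by simp
    then show ?thesis using nL by simp
  next
    \<comment> \<open>A small \<open>L\<close> says little about \<open>m\<close> directly, but it
      forces \<open>\<epsilon>\<^sup>2 * (1 - t) \<ge> 1 / 4\<close>, whence
      \<open>m \<ge> n / 4\<close>.\<close>
    case False
    have "log 2 (1 / (\<epsilon>\<^sup>2 * (1 - t))) = 2 * log 2 (1 / \<epsilon>) + log 2 (1 / (1 - t))"
      using \<epsilon> t by (simp add: log_divide log_mult log_nat_power)
    also have "\<dots> \<le> 2" using L False by (simp add: L_def)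
    finally have "1 / (\<epsilon>\<^sup>2 * (1 - t)) \<le> 2 powr 2"
      using \<epsilon> t by (subst (asm) log_le_iff) auto
    then have "1 / 4 \<le> \<epsilon>\<^sup>2 * (1 - t)"
      using \<epsilon> t by (simp add: field_simps)
    then have "real n * (1 / 4) \<le> real n * (\<epsilon>\<^sup>2 * (1 - t))"
      by (intro mult_left_mono) auto
    then show ?thesis using n unfolding m_def mult.assoc by linarith
  qed
  then show "m \<ge> 1" by simp
  \<comment> \<open>With the fourth root, \<open>ln m = 4 * ln r \<le> 4 * r\<close> is of lower
    order than \<open>sqrt m = r\<^sup>2\<close>.\<close>
  define r where "r = sqrt (sqrt m)"
  have "r\<^sup>2 = sqrt m" and "r > 0"
    using m0 by (simp_all add: r_def)
  moreover have "r ^ 4 = (r\<^sup>2)\<^sup>2"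
    by (simp flip: power_mult)
  ultimately have r: "r\<^sup>2 = sqrt m" "r ^ 4 = m" "r > 0"
    using m0 by simp_all
  have r_large: "r \<ge> 1000"
  proof -
    have "(1000 :: real) ^ 4 \<le> r ^ 4" using m_large r by simp
    then show ?thesis using r(3) by (subst (asm) power_mono_iff) auto
  qed
  have "(10 ^ 20 * L)\<^sup>2 \<le> (r\<^sup>2)\<^sup>2"
    using nL m0 by (simp add: r(1) power_mult_distrib)
  then have L_le: "10 ^ 20 * L \<le> r\<^sup>2"
    by (rule power2_le_imp_le) simp
  have "real n = m * (1 / \<epsilon>) ^ 2 * (1 / (1 - t))"
    using \<epsilon> t by (simp add: m_def field_simps)
  then have "ln (real n) = ln m + 2 * ln (1 / \<epsilon>) + ln (1 / (1 - t))"
    using m0 \<epsilon> t by (simp add: ln_mult ln_div ln_realpow)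
  also have "ln m = 4 * ln r"
    using r by (metis ln_realpow of_nat_numeral)
  also have "ln r \<le> r" using ln_le_minus_one[of r] r by simp
  also have "ln (1 / \<epsilon>) \<le> log 2 (1 / \<epsilon>)" using \<epsilon> by (intro ln_le_log2) simp
  also have "ln (1 / (1 - t)) \<le> log 2 (1 / (1 - t))" using t by (intro ln_le_log2) simp
  finally have "ln (real n) \<le> 4 * r + 2 * L"
    using L by (simp add: L_def)
  moreover have "r\<^sup>2 \<ge> 1000 * r"
    using r_large by (simp add: power2_eq_square)
  \<comment> \<open>The factor 54 is the square root of 2916.\<close>
  ultimately have le: "54 * (1 + ln (real n)) \<le> r\<^sup>2"
    using L_le r_large by simp
  have "ln (real n) \<ge> 0" using n by simp
  then have "(54 * (1 + ln (real n)))\<^sup>2 \<le> (r\<^sup>2)\<^sup>2"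
    using le by (intro power_mono) auto
  then show "2916 * (1 + ln (real n))\<^sup>2 \<le> m"
    using m0 by (simp only: r(1) power_mult_distrib) simp
qed

theorem proposition6p5:
  shows "\<exists>C>0. \<exists>K>0. \<forall>(\<epsilon>::real) (t::real) (n::nat) (P :: (nat \<Rightarrow> real) set).
    0 < \<epsilon> \<longrightarrow> \<epsilon> < 1 \<longrightarrow> 0 < t \<longrightarrow> t < 1 \<longrightarrow> local_property n P \<longrightarrow>
    real n \<ge> C * (log 2 (1 / \<epsilon>) + log 2 (1 / (1 - t)))\<^sup>2 / (\<epsilon>\<^sup>2 * (1 - t)) \<longrightarrow>
    (\<exists>T q. eps_tester n \<epsilon> P (erasure_strategies n t) T \<and>
       one_sided_error P (erasure_strategies n t) T \<and>
       makes_at_most q T \<and> real q \<le> K * \<bar>log 2 (\<epsilon> * real n) / (\<epsilon> * (1 - t))\<bar>) \<and>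
    (\<exists>T q. eps_tester n \<epsilon> P (corruption_strategies n t) T \<and>
       makes_at_most q T \<and> real q \<le> K * \<bar>log 2 (\<epsilon> * real n) / (\<epsilon> * (1 - t))\<bar>)"
proof (rule exI[of _ "10 ^ 40"], rule conjI, simp, rule exI[of _ "8 * 10 ^ 12"], rule conjI, simp,
    intro allI impI)
  fix \<epsilon> t :: real and n :: nat and P :: "(nat \<Rightarrow> real) set"
  \<comment> \<open>Twice the threshold between short and long inputs: for short inputs with
    \<open>n \<ge> 2\<close> it will turn out that \<open>?X \<ge> 1 / 2\<close>, so
    \<open>?K * ?X\<close> exceeds \<open>n\<close>.\<close>
  let ?K = "8 * 10 ^ 12 :: real"
  let ?X = "\<bar>log 2 (\<epsilon> * real n) / (\<epsilon> * (1 - t))\<bar>"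
  assume \<epsilon>: "0 < \<epsilon>" "\<epsilon> < 1" and t: "0 < t" "t < 1" and loc: "local_property n P"
  define L where "L = log 2 (1 / \<epsilon>) + log 2 (1 / (1 - t))"
  assume nL: "real n \<ge> 10 ^ 40 * (log 2 (1 / \<epsilon>) + log 2 (1 / (1 - t)))\<^sup>2 / (\<epsilon>\<^sup>2 * (1 - t))"
  have nL': "10 ^ 40 * L\<^sup>2 \<le> real n * \<epsilon>\<^sup>2 * (1 - t)"
    using nL \<epsilon> t by (simp add: L_def field_simps)
  have L: "log 2 (1 / \<epsilon>) > 0" "log 2 (1 / (1 - t)) > 0"
    using \<epsilon> t by simp_all
  have adv: "\<And>f S. S \<in> erasure_strategies n t f \<Longrightarrow> fixed_rate_strategy n t f S"
    "\<And>f S. S \<in> corruption_strategies n t f \<Longrightarrow> fixed_rate_strategy n t f S"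
    by (simp_all add: erasure_strategies_def corruption_strategies_def)
  have "\<exists>T q. eps_tester n \<epsilon> P (erasure_strategies n t) T \<and>
       one_sided_error P (erasure_strategies n t) T \<and> eps_tester n \<epsilon> P (corruption_strategies n t) T \<and>
       makes_at_most q T \<and> real q \<le> ?K * ?X"
  proof -
    have "real n > 0"
      using nL' L \<epsilon> t by (cases n) (auto simp: L_def)
    then consider "n = 1" | "n \<ge> 2" "real n < 4 * 10 ^ 12" | "real n \<ge> 4 * 10 ^ 12"
      by force
    then show ?thesis
    proof cases
      case 1
      then show ?thesis
        using trivial_tester[of P \<epsilon>] loc \<epsilon> by (intro exI[of _ "return_pmf Accept"] exI[of _ 0]) auto
    next
      case 2
      have "\<epsilon>\<^sup>2 * (1 - t) \<le> 1"
        using \<epsilon> t by (intro mult_le_one power_le_one) auto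
      then have "real n * \<epsilon>\<^sup>2 * (1 - t) \<le> real n"
        by (simp add: mult.assoc mult_left_le)
      also have "real n \<le> 10 ^ 14" using 2(2) by simp
      finally have "10 ^ 40 * L\<^sup>2 \<le> 10 ^ 14"
        using nL' by (rule order_trans[rotated])
      then have "(10 ^ 13 * L)\<^sup>2 \<le> 1\<^sup>2"
        by (simp add: power_mult_distrib)
      then have L13: "10 ^ 13 * L \<le> 1"
        by (rule power2_le_imp_le) simp
      \<comment> \<open>A bounded \<open>n\<close> has forced \<open>L\<close> below
        \<open>1 / 10 ^ 13\<close>. As \<open>t \<le> L\<close>, this makes \<open>n * t\<close>
        less than 1.\<close>
      have "t \<le> ln (1 / (1 - t))"
        using ln_le_minus_one[of "1 - t"] t by (simp add: ln_div)
      also have "\<dots> \<le> log 2 (1 / (1 - t))" using t by (intro ln_le_log2) simp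
      also have "\<dots> \<le> L" using L by (simp add: L_def)
      finally have "t \<le> L" .
      then have "real n * t \<le> (4 * 10 ^ 12) * L"
        using 2 t by (intro mult_mono) auto
      then have nt: "real n * t < 1" using L13 by simp
      obtain T where T: "makes_at_most n T"
        "\<And>Adv. (\<And>f S. S \<in> Adv f \<Longrightarrow> fixed_rate_strategy n t f S) \<Longrightarrow>
          eps_tester n \<epsilon> P Adv T \<and> one_sided_error P Adv T"
        using exact_tester[of n t \<epsilon> P] 2 t nt \<epsilon> loc unfolding local_property_def by auto
      have "1 \<le> log 2 (real n)"
        using 2 by (simp add: le_log_iff)
      then have "1 / 2 \<le> log 2 (real n) - log 2 (1 / \<epsilon>)"
        using L L13 by (simp add: L_def)
      also have "\<dots> = log 2 (\<epsilon> * real n)"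
        using \<epsilon> 2 by (simp add: log_mult log_divide)
      finally have log: "1 / 2 \<le> log 2 (\<epsilon> * real n)" .
      also have "\<dots> \<le> log 2 (\<epsilon> * real n) / (\<epsilon> * (1 - t))"
        using \<epsilon> t log mult_left_le[of "\<epsilon> * (1 - t)" "log 2 (\<epsilon> * real n)"] mult_le_one[of \<epsilon> "1 - t"]
        by (subst pos_le_divide_eq) auto
      also have "\<dots> \<le> ?X" by (rule abs_ge_self)
      finally have "1 / 2 \<le> ?X" .
      then have "?K * (1 / 2) \<le> ?K * ?X" by (intro mult_left_mono) auto
      then have "real n \<le> ?K * ?X" using 2 by simp
      then show ?thesis using T(1) T(2)[OF adv(1)] T(2)[OF adv(2)] by blast
    next
      case 3
      note size = input_size_bounds[OF \<epsilon> t 3 nL'[unfolded L_def]]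
      have n2: "n \<ge> 2" using 3 by simp
      obtain T q where T: "eps_tester n \<epsilon> P (erasure_strategies n t) T"
        "one_sided_error P (erasure_strategies n t) T"
        "eps_tester n \<epsilon> P (corruption_strategies n t) T"
        "makes_at_most q T" and q: "real q \<le> 27 * (1 + ln (real n)) / (\<epsilon> * (1 - t))"
        using long_input_tester[OF n2 \<epsilon> t loc size(1)] by blast
      \<comment> \<open>From \<open>m \<ge> 1\<close> follows
        \<open>n \<le> (\<epsilon> * n)\<^sup>2\<close>, which trades \<open>log n\<close> for
        \<open>2 * log (\<epsilon> * n)\<close>.\<close>
      have "real n * \<epsilon>\<^sup>2 * (1 - t) \<le> real n * \<epsilon>\<^sup>2"
        using t by (intro mult_left_le) auto
      then have "1 \<le> real n * \<epsilon>\<^sup>2" using size(2) by simp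
      then have "real n * 1 \<le> real n * (real n * \<epsilon>\<^sup>2)"
        by (intro mult_left_mono) auto
      then have "log 2 (real n) \<le> log 2 ((\<epsilon> * real n)\<^sup>2)"
        using n2 \<epsilon> by (subst log_le_cancel_iff) (auto simp: power2_eq_square algebra_simps)
      then have log: "log 2 (real n) \<le> 2 * log 2 (\<epsilon> * real n)"
        using n2 \<epsilon> by (simp add: log_nat_power)
      have ln1: "1 \<le> ln (real n)"
        using 3 exp_le by (subst ln_ge_iff) auto
      have "27 * (1 + ln (real n)) \<le> 54 * log 2 (real n)"
        using ln1 ln_le_log2[of "real n"] n2 by simp
      also have "\<dots> \<le> ?K * log 2 (\<epsilon> * real n)"
        using log ln1 ln_le_log2[of "real n"] n2 by simp
      finally have "27 * (1 + ln (real n)) / (\<epsilon> * (1 - t)) \<le> ?K * log 2 (\<epsilon> * real n) / (\<epsilon> * (1 - t))"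
        using \<epsilon> t by (intro divide_right_mono) auto
      also have "\<dots> = ?K * (log 2 (\<epsilon> * real n) / (\<epsilon> * (1 - t)))"
        by simp
      also have "\<dots> \<le> ?K * ?X" by (rule mult_left_mono[OF abs_ge_self]) simp
      finally show ?thesis using T q by (meson order_trans)
    qed
  qed
  then show "(\<exists>T q. eps_tester n \<epsilon> P (erasure_strategies n t) T \<and>
       one_sided_error P (erasure_strategies n t) T \<and>
       makes_at_most q T \<and> real q \<le> ?K * ?X) \<and>
    (\<exists>T q. eps_tester n \<epsilon> P (corruption_strategies n t) T \<and>
       makes_at_most q T \<and> real q \<le> ?K * ?X)"
    by blast
qed

end
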